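(* For each even integer $c\ge 2$, let $\mathcal{P}_c$ be the Gauss–Legendre distribution with smallest output $p_0$; put $\eta_1=1/2$, $\eta_2=\sqrt{c}/2$, and let $\varepsilon_1=\varepsilon_1(c),\varepsilon_2=\varepsilon_2(c)\in(0,1)$ be such that $\log(1/\varepsilon_2)/\log(1/\varepsilon_1)$ stays bounded as $c\to\infty$. Set $\mathcal{R}=\min_{1\le\ell\le c}\mathcal{R}_{\ell,\mathcal{P}_c}$, $\psi_1=\psi_2=\sigma(p_0)$, let $x_i>0$ be defined by $x_ir(x_i)=\eta_i\mathcal{R}\psi_1/c$, $A_i=\frac{c}{(1-\eta_1-\eta_2/c)\mathcal{R}}\cdot\frac{\psi_2}{x_i}\log\frac{1}{\varepsilon_i}$ ($i=1,2$), and $m=A_1+A_2$. Then for all sufficiently large even $c$, $m<0.206021\cdot 100\,c^2\log(1/\varepsilon_1)$; that is, the code length $m$ is less than $20.6021\%$ of the Tardos code length $100c^2\log(1/\varepsilon_1)$.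
   Context: A finite bias distribution is a probability distribution supported on a finite subset of $(0,1)$ that is symmetric (outputs $a$ and $1-a$ with equal probability); $E_p$ is expectation over its output $p$. $\sigma(p)=\sqrt{(1-p)/p}$; $f_{\ell,x}(p)=p^x(1-p)^{\ell-x}(x\sigma(p)-(\ell-x)\sigma(1-p))$; $R_{\ell,x}=\max\{0,E_p[f_{\ell,x}(p)]\}$; $\mathcal{R}_{\ell,\mathcal{P}}=E_p[-f_{\ell,0}(p)]-\sum_{x=1}^{\ell-1}\binom{\ell}{x}R_{\ell,x}$. $r(t)=(e^t-1-t)/t^2$ for $t>0$. $\log$ is the natural logarithm. Gauss–Legendre distribution: for $c=2\nu$, let $\widetilde{L}_\nu(t)=\left.\left(\frac{d}{du}\right)^{\nu}(u^2-1)^{\nu}\right|_{u=2t-1}$; $\mathcal{P}_c$ takes as values the $\nu$ zeroes $p$ of $\widetilde L_\nu$, each with probability proportional to $\bigl((p(1-p))^{3/2}\widetilde L_\nu{}'(p)^2\bigr)^{-1}$. The Tardos code length for security parameter $\varepsilon_1=\varepsilon/N$ is $100c^2\lceil\log(N/\varepsilon)\rceil\ge 100c^2\log(1/\varepsilon_1)$. *)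

theory Defs
  imports "HOL-Analysis.Analysis" "HOL-Computational_Algebra.Polynomial"
begin

text \<open>A finite bias distribution is given by a finite support set S and (positive,
unnormalised) weights w; expectation is the normalised weighted sum.\<close>
definition fexp :: "real set \<Rightarrow> (real \<Rightarrow> real) \<Rightarrow> (real \<Rightarrow> real) \<Rightarrow> real" where
  "fexp S w g = (\<Sum>p\<in>S. w p * g p) / (\<Sum>p\<in>S. w p)"

definition sigma :: "real \<Rightarrow> real" where
  "sigma p = sqrt ((1 - p) / p)"

definition fTardos :: "nat \<Rightarrow> nat \<Rightarrow> real \<Rightarrow> real" where
  "fTardos l x p = p ^ x * (1 - p) ^ (l - x) *
      (real x * sigma p - real (l - x) * sigma (1 - p))"

definition Rlx :: "real set \<Rightarrow> (real \<Rightarrow> real) \<Rightarrow> nat \<Rightarrow> nat \<Rightarrow> real" where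
  "Rlx S w l x = max 0 (fexp S w (fTardos l x))"

definition calR :: "real set \<Rightarrow> (real \<Rightarrow> real) \<Rightarrow> nat \<Rightarrow> real" where
  "calR S w l = fexp S w (\<lambda>p. - fTardos l 0 p)
      - (\<Sum>x=1..l-1. real (l choose x) * Rlx S w l x)"

definition r_fun :: "real \<Rightarrow> real" where
  "r_fun t = (exp t - 1 - t) / t\<^sup>2"

text \<open>Shifted Legendre polynomial (unnormalised):
  L~_nu(t) = (d/du)^nu (u^2-1)^nu evaluated at u = 2t-1, as a polynomial in t.\<close>
definition Ltilde :: "nat \<Rightarrow> real poly" where
  "Ltilde \<nu> = pcompose ((pderiv ^^ \<nu>) ([:-1, 0, 1:] ^ \<nu>)) [:-1, 2:]"

definition GL_support :: "nat \<Rightarrow> real set" where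
  "GL_support c = {p. poly (Ltilde (c div 2)) p = 0}"

definition GL_weight :: "nat \<Rightarrow> real \<Rightarrow> real" where
  "GL_weight c p = 1 / ((p * (1 - p)) powr (3/2) * (poly (pderiv (Ltilde (c div 2))) p)\<^sup>2)"

end

theory Submission
  imports Defs
begin

text \<open>
  Up to the factor $\sqrt{p(1-p)}$, the function $f_{\ell,x}$ is the derivative of the polynomial
  $p^x(1-p)^{\ell-x}$, and the weights of $\mathcal P_c$ are the Gauss--Legendre weights divided by
  $\sqrt{p(1-p)}$. The quadrature is exact in degree less than $c$, so for all $\ell \le c$ the terms
  $R_{\ell,x}$ vanish and $\mathcal R_{\ell,\mathcal P_c}$ is the inverse of the quadrature sum of
  $1/\sqrt{p(1-p)}$. That sum is at most $\int_0^1 dp/\sqrt{p(1-p)} = \pi$ because the integrand is a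
  power series in $(2p-1)^2$ with nonnegative coefficients; hence $\mathcal R \ge 1/\pi$.
  For the smallest zero, $\widetilde L_\nu(t)$ is compared with the alternating series of
  $J_0(2\sqrt s)$, $s = \nu(\nu+1)t$, which gives $\sigma(p_0) \le 0.4162\,c$ for large $c$.
  Asymptotically $m/(c^2\log(1/\varepsilon_1))$ is then at most $4\pi^2 r(X)$ for any $X$ with
  $2\pi X r(X) \ge 0.4162$, and $X = 0.12695$ is good enough; $A_2$ is of lower order.
\<close>

section \<open>Rolle arguments and zeros of Legendre polynomials\<close>

text \<open>Each new largest zero yields one critical point in the gap below it. Disjointness from
  \<open>A\<close> lets \<open>quadrature_le\<close> count double zeros and Rolle points together;
  the bounds keep Legendre zeros inside the unit interval.\<close>

lemma poly_rolle_finite_set: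
  fixes p :: "real poly"
  assumes "finite A" "A \<noteq> {}" "\<And>a. a \<in> A \<Longrightarrow> poly p a = 0"
  shows "\<exists>B. finite B \<and> Suc (card B) = card A \<and> A \<inter> B = {} \<and>
           (\<forall>b\<in>B. poly (pderiv p) b = 0 \<and> Min A < b \<and> b < Max A)"
  using assms
proof (induction A rule: finite_linorder_max_induct)
  case empty
  then show ?case by simp
next
  case (insert m A)
  show ?case
  proof (cases "A = {}")
    case True
    then show ?thesis by (intro exI[of _ "{}"]) simp
  next
    case False
    then obtain B where B: "finite B" "Suc (card B) = card A" "A \<inter> B = {}"
      "\<And>b. b \<in> B \<Longrightarrow> poly (pderiv p) b = 0 \<and> Min A < b \<and> b < Max A"
      using insert by blast
    have mA: "Max A \<in> A" "Max A < m" "m \<notin> A"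
      using False insert by auto
    obtain z where z: "Max A < z" "z < m" "poly p m - poly p (Max A) = (m - Max A) * poly (pderiv p) z"
      using poly_MVT[OF mA(2), of p] by blast
    have z0: "poly (pderiv p) z = 0"
      using z mA insert.prems(2) by auto
    have mn: "Min (insert m A) = Min A"
      using Min_le[OF insert.hyps(1) mA(1)] False insert.hyps(1) mA(2) by simp
    have mx: "Max (insert m A) = m"
      using False insert.hyps(1) mA(2) by simp
    have "z \<notin> B" "z \<notin> A" "m \<notin> B"
      using B(4)[of z] B(4)[of m] Max_ge[OF insert.hyps(1), of z] z mA(2) by auto
    moreover have "Min A \<le> Max A" using False insert.hyps(1) by simp
    moreover have "\<forall>b\<in>insert z B. poly (pderiv p) b = 0 \<and> Min A < b \<and> b < m"
      using B(4) z z0 mA(2) \<open>Min A \<le> Max A\<close> by fastforce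
    moreover have "Suc (card (insert z B)) = card (insert m A)" "finite (insert z B)"
      using B(1,2) \<open>z \<notin> B\<close> insert.hyps(1) mA(3) by auto
    moreover have "insert m A \<inter> insert z B = {}"
      using B(3) \<open>z \<notin> A\<close> \<open>m \<notin> B\<close> z(2) by auto
    ultimately show ?thesis
      unfolding mn mx by blast
  qed
qed

lemma higher_pderiv_has_root:
  fixes p :: "real poly"
  assumes "finite A" "n < card A" "\<And>a. a \<in> A \<Longrightarrow> poly p a = 0"
  shows "\<exists>x. poly ((pderiv ^^ n) p) x = 0"
  using assms
proof (induction n arbitrary: A p)
  case 0
  then show ?case by (auto simp: card_gt_0_iff)
next
  case (Suc n)
  have "A \<noteq> {}" using Suc.prems by auto
  then obtain B where "finite B" "Suc (card B) = card A" "\<And>b. b \<in> B \<Longrightarrow> poly (pderiv p) b = 0"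
    using poly_rolle_finite_set[OF Suc.prems(1) _ Suc.prems(3)] by blast
  then show ?case
    using Suc.IH[of B "pderiv p"] Suc.prems by (simp add: funpow_swap1)
qed

text \<open>A derivative lowers the multiplicity of the factor \<open>q\<close> by at most one. For
  \<open>kernel_poly\<close> this makes both endpoints zeros of every derivative of order below
  \<open>\<nu>\<close>.\<close>

lemma power_dvd_higher_pderiv:
  fixes q :: "'a :: idom poly"
  shows "q ^ (n - j) dvd (pderiv ^^ j) (q ^ n)"
proof (induction j)
  case 0
  then show ?case by simp
next
  case (Suc j)
  then obtain h where h: "(pderiv ^^ j) (q ^ n) = q ^ (n - j) * h" by (elim dvdE)
  show ?case
  proof (cases "n - j")
    case 0
    then have "n - Suc j = 0" by simp
    then show ?thesis by (simp only: power_0 one_dvd)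
  next
    case (Suc m)
    then have "n - Suc j = m" by simp
    then show ?thesis
      by (simp add: h Suc pderiv_mult pderiv_power_Suc del: power_Suc)
        (simp add: dvd_add dvd_smult)
  qed
qed

section \<open>Shifted Legendre polynomials through the Rodrigues formula\<close>

lemma higher_pderiv_pcompose_linear:
  fixes p :: "'a :: {idom, semiring_char_0} poly"
  shows "(pderiv ^^ n) (pcompose p [:a, b:]) = smult (b ^ n) (pcompose ((pderiv ^^ n) p) [:a, b:])"
proof (induction n)
  case (Suc n)
  then show ?case
    by (simp add: pderiv_smult pderiv_pcompose pderiv_pCons mult.commute)
qed simp

lemma pcompose_power: "pcompose (p ^ n) q = pcompose p q ^ n" for p q :: "'a :: comm_semiring_1 poly"
  by (induction n) (simp_all add: pcompose_mult pcompose_1)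

text \<open>This is t(t - 1), a quarter of u^2 - 1 at u = 2t - 1.\<close>

definition kernel_poly :: "real poly" where
  "kernel_poly = [:0, -1, 1:]"

lemma poly_kernel_poly [simp]: "poly kernel_poly 0 = 0" "poly kernel_poly 1 = 0"
  by (simp_all add: kernel_poly_def)

text \<open>Substituting u = 2t - 1 scales the base by 4, and moving each derivative outside the
  substitution costs a factor 2; per power of \<open>\<nu>\<close> a factor 2 remains.\<close>

lemma Ltilde_Rodrigues: "Ltilde \<nu> = smult (2 ^ \<nu>) ((pderiv ^^ \<nu>) (kernel_poly ^ \<nu>))"
proof -
  have "pcompose ([:-1, 0, 1:] ^ \<nu>) [:-1, 2:] = smult (4 ^ \<nu>) (kernel_poly ^ \<nu>)"
    by (simp add: pcompose_power pcompose_pCons kernel_poly_def flip: smult_power)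
  then have "smult (2 ^ \<nu>) (Ltilde \<nu>) = smult (4 ^ \<nu>) ((pderiv ^^ \<nu>) (kernel_poly ^ \<nu>))"
    using higher_pderiv_pcompose_linear[of \<nu> "[:-1, 0, 1:] ^ \<nu>" "-1" "2::real"]
    by (simp add: Ltilde_def higher_pderiv_smult)
  then have "smult (1 / 2 ^ \<nu>) (smult (2 ^ \<nu>) (Ltilde \<nu>)) =
      smult (1 / 2 ^ \<nu>) (smult (4 ^ \<nu>) ((pderiv ^^ \<nu>) (kernel_poly ^ \<nu>)))"
    by simp
  then show ?thesis
    by (simp add: power_divide[symmetric])
qed

text \<open>Below order \<open>\<nu>\<close> both endpoints are still zeros; together with
  \<open>j\<close> interior zeros they give \<open>j + 1\<close> interior critical points by
  Rolle.\<close>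

lemma higher_pderiv_kernel_poly_roots:
  assumes "j \<le> \<nu>"
  shows "\<exists>B. finite B \<and> card B = j \<and> B \<subseteq> {0<..<1} \<and>
    (\<forall>b\<in>B. poly ((pderiv ^^ j) (kernel_poly ^ \<nu>)) b = 0)"
  using assms
proof (induction j)
  case (Suc j)
  then obtain B where B: "finite B" "card B = j" "B \<subseteq> {0<..<1}"
    "\<And>b. b \<in> B \<Longrightarrow> poly ((pderiv ^^ j) (kernel_poly ^ \<nu>)) b = 0"
    by auto
  let ?A = "insert 0 (insert 1 B)"
  have "kernel_poly dvd kernel_poly ^ (\<nu> - j)"
    using Suc.prems by (intro dvd_power) auto
  also note power_dvd_higher_pderiv
  finally have "poly ((pderiv ^^ j) (kernel_poly ^ \<nu>)) 0 = 0" "poly ((pderiv ^^ j) (kernel_poly ^ \<nu>)) 1 = 0"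
    by (auto elim!: dvdE)
  then obtain C where C: "finite C" "Suc (card C) = card ?A"
    "\<And>b. b \<in> C \<Longrightarrow> poly (pderiv ((pderiv ^^ j) (kernel_poly ^ \<nu>))) b = 0 \<and> Min ?A < b \<and> b < Max ?A"
    using poly_rolle_finite_set[of ?A "(pderiv ^^ j) (kernel_poly ^ \<nu>)"] B(1,4) by blast
  have "0 \<notin> insert 1 B" "1 \<notin> B" using B(3) by auto
  then have "card ?A = j + 2" using B by simp
  moreover have "Min ?A = 0" "Max ?A = 1"
    by (rule Min_eqI Max_eqI; use B(1,3) in \<open>force intro: less_imp_le\<close>)+
  ultimately show ?case
    using C by (intro exI[of _ C]) auto
qed (auto intro: exI[of _ "{}"])

lemma degree_Ltilde [simp]: "degree (Ltilde \<nu>) = \<nu>"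
  by (simp add: Ltilde_Rodrigues degree_higher_pderiv degree_power_eq kernel_poly_def)

text \<open>The \<open>\<nu>\<close> zeros found by Rolle already exhaust the degree.\<close>

lemma Ltilde_roots:
  shows card_Ltilde_roots: "card {x. poly (Ltilde \<nu>) x = 0} = \<nu>"
    and Ltilde_roots_subset: "{x. poly (Ltilde \<nu>) x = 0} \<subseteq> {0<..<1}"
    and finite_Ltilde_roots: "finite {x. poly (Ltilde \<nu>) x = 0}"
proof -
  have "(pderiv ^^ \<nu>) (kernel_poly ^ \<nu>) \<noteq> 0"
  proof (cases "\<nu> = 0")
    case False
    have "degree (Ltilde \<nu>) = \<nu>" by simp
    then show ?thesis using False by (auto simp: Ltilde_Rodrigues)
  qed auto
  then have "Ltilde \<nu> \<noteq> 0" by (simp add: Ltilde_Rodrigues)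
  then have f: "finite {x. poly (Ltilde \<nu>) x = 0}" and c: "card {x. poly (Ltilde \<nu>) x = 0} \<le> \<nu>"
    using card_poly_roots_bound[of "Ltilde \<nu>"] poly_roots_finite by auto
  obtain B where B: "finite B" "card B = \<nu>" "B \<subseteq> {0<..<1}" "B \<subseteq> {x. poly (Ltilde \<nu>) x = 0}"
    using higher_pderiv_kernel_poly_roots[of \<nu> \<nu>] by (auto simp: Ltilde_Rodrigues)
  have "B = {x. poly (Ltilde \<nu>) x = 0}"
    using f c B by (intro card_seteq) auto
  then show "card {x. poly (Ltilde \<nu>) x = 0} = \<nu>" "{x. poly (Ltilde \<nu>) x = 0} \<subseteq> {0<..<1}"
    "finite {x. poly (Ltilde \<nu>) x = 0}"
    using B by auto
qed

section \<open>Integration of polynomials over the unit interval and orthogonality\<close>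

definition unit_integral :: "real poly \<Rightarrow> real" where
  "unit_integral q = integral {0..1} (poly q)"

lemma poly_integrable: "poly q integrable_on {0..1}" for q :: "real poly"
  by (intro integrable_continuous_real continuous_intros)

lemma unit_integral_add: "unit_integral (p + q) = unit_integral p + unit_integral q"
proof -
  have "poly (p + q) = (\<lambda>x. poly p x + poly q x)" by auto
  then show ?thesis
    using integral_add[OF poly_integrable[of p] poly_integrable[of q]] by (simp add: unit_integral_def)
qed

lemma unit_integral_smult: "unit_integral (smult c p) = c * unit_integral p"
proof -
  have "poly (smult c p) = (\<lambda>x. c * poly p x)" by auto
  then show ?thesis by (simp add: unit_integral_def)
qed

lemma unit_integral_0 [simp]: "unit_integral 0 = 0"
  using unit_integral_smult[of 0 0] by simp

lemma unit_integral_diff: "unit_integral (p - q) = unit_integral p - unit_integral q"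
  using unit_integral_add[of "p - q" q] by simp

lemma unit_integral_sum: "unit_integral (\<Sum>x\<in>A. f x) = (\<Sum>x\<in>A. unit_integral (f x))"
  by (induction A rule: infinite_finite_induct) (simp_all add: unit_integral_add)

lemma unit_integral_pderiv: "unit_integral (pderiv p) = poly p 1 - poly p 0"
  unfolding unit_integral_def
  by (intro integral_unique fundamental_theorem_of_calculus)
     (simp_all add: has_real_derivative_iff_has_vector_derivative[symmetric] DERIV_subset[OF poly_DERIV])

text \<open>The exceptional set is there because \<open>quadrature_le\<close> controls the sign of a
  quotient only off the nodes.\<close>

lemma unit_integral_nonneg:
  assumes "finite F" "\<And>x. x \<notin> F \<Longrightarrow> 0 \<le> poly p x"
  shows "0 \<le> unit_integral p"
proof -
  have "integral {0..1} (poly p) = integral {0..1} (\<lambda>x. if x \<in> F then 0 else poly p x)"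
    using assms(1) by (intro integral_spike[of F]) auto
  also have "\<dots> \<ge> 0"
    using assms(2) by (intro integral_nonneg integrable_spike[OF poly_integrable, of F])
      (use assms(1) in auto)
  finally show ?thesis by (simp add: unit_integral_def)
qed

lemma higher_pderiv_eq_0: "degree q < n \<Longrightarrow> (pderiv ^^ n) q = 0"
  by (intro poly_eqI) (simp add: coeff_higher_pderiv coeff_eq_0)

text \<open>Repeated integration by parts moves all derivatives onto \<open>q\<close>, which they
  annihilate; the boundary terms vanish since \<open>kernel_poly\<close> still divides the other
  factor.\<close>

lemma Ltilde_orthogonal:
  assumes "degree q < \<nu>"
  shows "unit_integral (Ltilde \<nu> * q) = 0"
proof -
  have "unit_integral ((pderiv ^^ j) (kernel_poly ^ \<nu>) * q) = 0"
    if "j \<le> \<nu>" "(pderiv ^^ j) q = 0" for j q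
    using that
  proof (induction j arbitrary: q)
    case (Suc j)
    let ?g = "(pderiv ^^ j) (kernel_poly ^ \<nu>)"
    have "kernel_poly dvd kernel_poly ^ (\<nu> - j)"
      using Suc.prems by (intro dvd_power) auto
    also note power_dvd_higher_pderiv
    finally have g0: "poly ?g 0 = 0" "poly ?g 1 = 0"
      by (auto elim!: dvdE)
    have "unit_integral (?g * pderiv q) = 0"
      using Suc.IH[of "pderiv q"] Suc.prems by (simp add: funpow_swap1)
    moreover have "pderiv ?g * q = pderiv (?g * q) - ?g * pderiv q"
      by (simp add: pderiv_mult)
    ultimately show ?case
      using g0 by (simp add: unit_integral_diff unit_integral_pderiv)
  qed simp
  then show ?thesis
    using assms by (simp add: Ltilde_Rodrigues higher_pderiv_eq_0 unit_integral_smult)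
qed

text \<open>\<open>kernel_poly\<close> is invariant under t -> 1 - t, and each derivative
  contributes a sign.\<close>

lemma poly_Ltilde_reflect: "poly (Ltilde \<nu>) (1 - t) = (-1) ^ \<nu> * poly (Ltilde \<nu>) t"
proof -
  have "pcompose (kernel_poly ^ \<nu>) [:1, -1:] = kernel_poly ^ \<nu>"
    by (simp add: pcompose_power kernel_poly_def pcompose_pCons)
  then have eq: "(pderiv ^^ \<nu>) (kernel_poly ^ \<nu>) =
      smult ((-1) ^ \<nu>) (pcompose ((pderiv ^^ \<nu>) (kernel_poly ^ \<nu>)) [:1, -1:])"
    using higher_pderiv_pcompose_linear[of \<nu> "kernel_poly ^ \<nu>" 1 "-1"] by simp
  show ?thesis
    using arg_cong[OF eq, of "\<lambda>q. poly q (1 - t)"]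
    by (simp only: Ltilde_Rodrigues poly_smult poly_pcompose) simp
qed

section \<open>Gauss quadrature\<close>

text \<open>As many zeros as the degree makes all of them simple. The assumption
  \<open>endpoints\<close> merges the two boundary terms in \<open>wt_eq\<close> into one closed
  form.\<close>

locale gauss_quadrature =
  fixes L :: "real poly" and n :: nat
  assumes degree_L: "degree L = n"
    and n_pos: "0 < n"
    and card_roots: "card {x. poly L x = 0} = n"
    and roots_unit: "{x. poly L x = 0} \<subseteq> {0<..<1}"
    and orthogonal: "\<And>q. degree q < n \<Longrightarrow> unit_integral (L * q) = 0"
    and endpoints: "(poly L 0)\<^sup>2 = (poly L 1)\<^sup>2"
begin

definition nodes :: "real set" where
  "nodes = {x. poly L x = 0}"

definition cofactor :: "real \<Rightarrow> real poly" where
  "cofactor p = L div [:-p, 1:]"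

text \<open>The Christoffel weight: the integral of the Lagrange basis polynomial at
  \<open>p\<close>, as the cofactor takes the value L'(p) there.\<close>

definition wt :: "real \<Rightarrow> real" where
  "wt p = unit_integral (cofactor p) / poly (pderiv L) p"

lemma L_nonzero: "L \<noteq> 0"
  using degree_L n_pos by auto

lemma finite_nodes: "finite nodes"
  using poly_roots_finite[OF L_nonzero] by (simp add: nodes_def)

lemma card_nodes: "card nodes = n"
  using card_roots by (simp add: nodes_def)

lemma nodes_bounds: "p \<in> nodes \<Longrightarrow> 0 < p \<and> p < 1"
  using roots_unit by (auto simp: nodes_def)

lemma poly_L_node: "p \<in> nodes \<Longrightarrow> poly L p = 0"
  by (simp add: nodes_def)

lemma L_eq_cofactor: "p \<in> nodes \<Longrightarrow> L = [:-p, 1:] * cofactor p"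
  by (simp only: nodes_def mem_Collect_eq poly_eq_0_iff_dvd cofactor_def dvd_mult_div_cancel)

lemma cofactor_nonzero: "p \<in> nodes \<Longrightarrow> cofactor p \<noteq> 0"
  using L_eq_cofactor L_nonzero by force

lemma degree_cofactor: "p \<in> nodes \<Longrightarrow> Suc (degree (cofactor p)) = n"
  using degree_mult_eq[of "[:-p, 1:]" "cofactor p"] L_eq_cofactor[of p] cofactor_nonzero[of p] degree_L
  by simp

lemma poly_cofactor: "p \<in> nodes \<Longrightarrow> poly L x = (x - p) * poly (cofactor p) x"
  by (subst L_eq_cofactor) (simp_all add: algebra_simps)

lemma poly_cofactor_other: "p \<in> nodes \<Longrightarrow> q \<in> nodes \<Longrightarrow> q \<noteq> p \<Longrightarrow> poly (cofactor p) q = 0"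
  using poly_cofactor[of p q] poly_L_node[of q] by simp

lemma pderiv_L_cofactor: "p \<in> nodes \<Longrightarrow> pderiv L = cofactor p + [:-p, 1:] * pderiv (cofactor p)"
  by (subst L_eq_cofactor, assumption) (simp only: pderiv_mult, simp add: pderiv_pCons)

lemma poly_cofactor_same: "p \<in> nodes \<Longrightarrow> poly (cofactor p) p = poly (pderiv L) p"
  by (subst pderiv_L_cofactor) (simp_all add: algebra_simps)

text \<open>A double zero would make the cofactor, of degree \<open>n - 1\<close>, vanish at all
  \<open>n\<close> nodes.\<close>

lemma poly_pderiv_L_nonzero:
  assumes "p \<in> nodes"
  shows "poly (pderiv L) p \<noteq> 0"
proof
  assume "poly (pderiv L) p = 0"
  then have "nodes \<subseteq> {x. poly (cofactor p) x = 0}"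
    using poly_cofactor_other[OF assms] poly_cofactor_same[OF assms] by auto
  then have "n \<le> card {x. poly (cofactor p) x = 0}"
    using card_nodes poly_roots_finite[OF cofactor_nonzero[OF assms]] by (metis card_mono)
  also have "\<dots> \<le> degree (cofactor p)"
    using card_poly_roots_bound cofactor_nonzero[OF assms] by blast
  finally show False
    using degree_cofactor[OF assms] by simp
qed

lemma lagrange_interpolation:
  assumes "degree b < n"
  shows "b = (\<Sum>p\<in>nodes. smult (poly b p / poly (pderiv L) p) (cofactor p))"
proof (rule poly_eqI_degree[of nodes])
  fix x assume x: "x \<in> nodes"
  have "poly (\<Sum>p\<in>nodes. smult (poly b p / poly (pderiv L) p) (cofactor p)) x =
      (\<Sum>p\<in>nodes. if p = x then poly b x else 0)"
    unfolding poly_sum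
    using x poly_cofactor_other poly_cofactor_same poly_pderiv_L_nonzero
    by (intro sum.cong) auto
  then show "poly b x = poly (\<Sum>p\<in>nodes. smult (poly b p / poly (pderiv L) p) (cofactor p)) x"
    using x finite_nodes by simp
next
  have "degree (smult (poly b p / poly (pderiv L) p) (cofactor p)) < n" if "p \<in> nodes" for p
    using degree_cofactor[OF that] degree_smult_le[of "poly b p / poly (pderiv L) p" "cofactor p"] by linarith
  then show "degree (\<Sum>p\<in>nodes. smult (poly b p / poly (pderiv L) p) (cofactor p)) < card nodes"
    using n_pos by (simp add: card_nodes degree_sum_less)
qed (simp add: card_nodes assms)

text \<open>Divide by \<open>L\<close>: the quotient has degree below \<open>n\<close> and is
  orthogonal to \<open>L\<close>, while the remainder agrees with \<open>q\<close> at the nodes and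
  is integrated by Lagrange interpolation.\<close>

lemma quadrature_exact:
  assumes "degree q < 2 * n"
  shows "unit_integral q = (\<Sum>p\<in>nodes. wt p * poly q p)"
proof -
  let ?d = "q div L" and ?b = "q mod L"
  have q: "q = L * ?d + ?b" by simp
  have b: "degree ?b < n"
    using degree_mod_less[OF L_nonzero, of q] degree_L n_pos by auto
  have "degree ?d < n"
  proof (cases "?d = 0")
    case False
    then have "degree (L * ?d) = n + degree ?d"
      using L_nonzero degree_L by (simp add: degree_mult_eq)
    then have "degree q = n + degree ?d"
      using b degree_add_eq_left[of ?b "L * ?d"] q by simp
    then show ?thesis using assms by simp
  qed (use n_pos in simp)
  then have "unit_integral q = unit_integral ?b"
    by (subst q) (simp only: unit_integral_add orthogonal add_0)
  also have "\<dots> = (\<Sum>p\<in>nodes. wt p * poly ?b p)"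
    by (subst lagrange_interpolation[OF b])
      (simp add: unit_integral_sum unit_integral_smult wt_def mult.commute)
  also have "\<dots> = (\<Sum>p\<in>nodes. wt p * poly q p)"
  proof (rule sum.cong)
    fix p assume "p \<in> nodes"
    then have "poly q p = poly ?b p"
      by (subst q) (simp only: poly_add poly_mult poly_L_node mult_zero_left add_0)
    then show "wt p * poly ?b p = wt p * poly q p" by simp
  qed simp
  finally show ?thesis .
qed

lemma quadrature_cofactor:
  assumes "p \<in> nodes" "degree q < Suc n"
  shows "unit_integral (cofactor p * q) = wt p * poly (pderiv L) p * poly q p"
proof -
  have "degree (cofactor p * q) < 2 * n"
    using degree_mult_le[of "cofactor p" q] degree_cofactor[OF assms(1)] assms(2) by linarith
  then have "unit_integral (cofactor p * q) = (\<Sum>x\<in>nodes. wt x * poly (cofactor p * q) x)"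
    by (rule quadrature_exact)
  also have "\<dots> = (\<Sum>x\<in>nodes. if x = p then wt p * poly (pderiv L) p * poly q p else 0)"
    using assms(1) poly_cofactor_other poly_cofactor_same by (intro sum.cong) auto
  finally show ?thesis using finite_nodes assms(1) by simp
qed

text \<open>Integrating $((x-p)\ell^2)' = 2\ell L' - \ell^2$, where $L = (x-p)\ell$, evaluates the weight
  at \<open>p\<close> from the boundary values of \<open>L\<close>.\<close>

lemma wt_eq:
  assumes "p \<in> nodes"
  shows "wt p * (poly (pderiv L) p)\<^sup>2 = (poly L 1)\<^sup>2 / (p * (1 - p))"
proof -
  let ?l = "cofactor p"
  have p: "0 < p" "p < 1" using nodes_bounds[OF assms] by auto
  have "pderiv ([:-p, 1:] * ?l\<^sup>2) = ?l * (pderiv L + pderiv L - ?l)"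
    unfolding pderiv_L_cofactor[OF assms] pderiv_mult power2_eq_square
    by (simp add: pderiv_pCons algebra_simps)
  then have "unit_integral (?l * pderiv L) + unit_integral (?l * pderiv L) - unit_integral (?l * ?l) =
      poly ([:-p, 1:] * ?l\<^sup>2) 1 - poly ([:-p, 1:] * ?l\<^sup>2) 0"
    by (simp only: unit_integral_pderiv[symmetric])
      (simp only: distrib_left right_diff_distrib unit_integral_add unit_integral_diff)
  \<comment> \<open>Both products reduce to the node \<open>p\<close>, where the cofactor equals
    L'(p); two copies minus one leave a single term.\<close>
  moreover have "unit_integral (?l * pderiv L) = wt p * (poly (pderiv L) p)\<^sup>2"
    using quadrature_cofactor[OF assms, of "pderiv L"] degree_L
    by (simp add: degree_pderiv power2_eq_square)
  moreover have "unit_integral (?l * ?l) = wt p * (poly (pderiv L) p)\<^sup>2"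
    using quadrature_cofactor[OF assms, of ?l] degree_cofactor[OF assms] poly_cofactor_same[OF assms]
    by (simp add: power2_eq_square)
  ultimately have "wt p * (poly (pderiv L) p)\<^sup>2 = (1 - p) * (poly ?l 1)\<^sup>2 + p * (poly ?l 0)\<^sup>2"
    by (simp add: algebra_simps)
  also have "poly ?l 1 = poly L 1 / (1 - p)"
    using p by (simp add: poly_cofactor[OF assms])
  also have "poly ?l 0 = - (poly L 0 / p)"
    using p by (simp add: poly_cofactor[OF assms])
  also have "(1 - p) * (poly L 1 / (1 - p))\<^sup>2 + p * (- (poly L 0 / p))\<^sup>2 = (poly L 1)\<^sup>2 / (p * (1 - p))"
  proof -
    have "(1 - p) * (poly L 1 / (1 - p))\<^sup>2 = (poly L 1)\<^sup>2 / (1 - p)"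
      "p * (- (poly L 0 / p))\<^sup>2 = (poly L 1)\<^sup>2 / p"
      using p endpoints by (simp_all add: power_divide power2_eq_square)
    then show ?thesis
      using p by (simp add: add_frac_eq) (simp add: algebra_simps)
  qed
  finally show ?thesis .
qed

lemma poly_L_1_nonzero: "poly L 1 \<noteq> 0"
  using nodes_bounds[of 1] by (auto simp: nodes_def)

lemma wt_pos:
  assumes "p \<in> nodes"
  shows "0 < wt p"
proof -
  have "0 < wt p * (poly (pderiv L) p)\<^sup>2"
    using nodes_bounds[OF assms] poly_L_1_nonzero by (simp add: wt_eq[OF assms])
  then show ?thesis
    by (simp add: zero_less_mult_iff)
qed

text \<open>The remainder of \<open>f\<close> modulo $L^2$ is its Hermite interpolant at the nodes; the sign of the
  quotient comes from the usual Rolle argument for the interpolation error.\<close>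

lemma quadrature_le:
  assumes "\<And>x. 0 \<le> poly ((pderiv ^^ (2 * n)) f) x"
  shows "(\<Sum>p\<in>nodes. wt p * poly f p) \<le> unit_integral f"
proof -
  let ?d = "f div L\<^sup>2" and ?r = "f mod L\<^sup>2"
  have f: "f = L\<^sup>2 * ?d + ?r" by simp
  have L2: "L\<^sup>2 \<noteq> 0" "degree (L\<^sup>2) = 2 * n"
    using L_nonzero degree_L by (simp_all add: degree_power_eq)
  have r: "degree ?r < 2 * n"
    using degree_mod_less[OF L2(1), of f] L2(2) n_pos by auto
  have d_nonneg: "0 \<le> poly ?d u" if u: "u \<notin> nodes" for u
  proof -
    \<comment> \<open>\<open>F\<close> has double zeros at the nodes and, by the choice of the
      constant, a further zero at \<open>u\<close>.\<close>
    define F where "F = f - ?r - smult (poly ?d u) (L\<^sup>2)"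
    have F: "F = L\<^sup>2 * (?d - [:poly ?d u:])"
      unfolding F_def by (subst f) (simp add: algebra_simps)
    have zeros: "poly F a = 0" if "a \<in> insert u nodes" for a
      using that by (auto simp: F poly_L_node)
    obtain B where B: "finite B" "Suc (card B) = card (insert u nodes)" "insert u nodes \<inter> B = {}"
      "\<And>b. b \<in> B \<Longrightarrow> poly (pderiv F) b = 0"
      using poly_rolle_finite_set[of "insert u nodes" F] zeros finite_nodes by blast
    \<comment> \<open>The \<open>n\<close> double zeros and the \<open>n\<close> Rolle points give
      \<open>2 * n\<close> distinct zeros of the derivative.\<close>
    have "poly (pderiv F) a = 0" if "a \<in> nodes \<union> B" for a
      using that B(4) by (auto simp: F pderiv_mult power2_eq_square poly_L_node)
    moreover have "card (nodes \<union> B) = 2 * n"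
      using B u finite_nodes by (subst card_Un_disjoint) (auto simp: card_nodes)
    ultimately obtain \<xi> where "poly ((pderiv ^^ (2 * n - 1)) (pderiv F)) \<xi> = 0"
      using higher_pderiv_has_root[of "nodes \<union> B" "2 * n - 1" "pderiv F"] B(1) finite_nodes n_pos by auto
    moreover have "(pderiv ^^ (2 * n - 1)) (pderiv F) = (pderiv ^^ (2 * n)) F"
      using n_pos by (cases "2 * n") (simp_all add: funpow_swap1)
    ultimately have F0: "poly ((pderiv ^^ (2 * n)) F) \<xi> = 0" by simp
    \<comment> \<open>\<open>L\<^sup>2\<close> has degree \<open>2 * n\<close>, so only its leading
      term survives; \<open>pochhammer 1 (2 * n)\<close> is the factorial of
      \<open>2 * n\<close>.\<close>
    have top: "(pderiv ^^ (2 * n)) (L\<^sup>2) = [:pochhammer 1 (2 * n) * (lead_coeff L)\<^sup>2:]"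
    proof (rule poly_eqI)
      fix k
      show "coeff ((pderiv ^^ (2 * n)) (L\<^sup>2)) k = coeff [:pochhammer 1 (2 * n) * (lead_coeff L)\<^sup>2:] k"
        using L2(2) lead_coeff_power[of L 2]
        by (cases k) (simp_all add: coeff_higher_pderiv coeff_eq_0)
    qed
    have "(pderiv ^^ (2 * n)) F + smult (poly ?d u) ((pderiv ^^ (2 * n)) (L\<^sup>2)) + (pderiv ^^ (2 * n)) ?r
        = (pderiv ^^ (2 * n)) f"
      by (simp only: higher_pderiv_smult[symmetric] higher_pderiv_add[symmetric] F_def) simp
    then have "poly ((pderiv ^^ (2 * n)) f) \<xi> = poly ?d u * (pochhammer 1 (2 * n) * (lead_coeff L)\<^sup>2)"
      unfolding top higher_pderiv_eq_0[OF r]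
      by (metis F0 add.right_neutral add_0 mult_zero_right poly_0 poly_add poly_pCons poly_smult)
    then have "0 \<le> poly ?d u * (pochhammer 1 (2 * n) * (lead_coeff L)\<^sup>2)"
      using assms[of \<xi>] by simp
    moreover have "0 < pochhammer 1 (2 * n) * (lead_coeff L)\<^sup>2"
      using L_nonzero by (simp add: pochhammer_pos)
    ultimately show ?thesis by (simp add: zero_le_mult_iff)
  qed
  have "0 \<le> unit_integral (L\<^sup>2 * ?d)"
    by (rule unit_integral_nonneg[OF finite_nodes]) (use d_nonneg in simp)
  moreover have "unit_integral f = unit_integral (L\<^sup>2 * ?d) + unit_integral ?r"
    by (subst f) (simp only: unit_integral_add)
  moreover have "unit_integral ?r = (\<Sum>p\<in>nodes. wt p * poly f p)"
    unfolding quadrature_exact[OF r]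
  proof (rule sum.cong)
    fix p assume "p \<in> nodes"
    then have "poly f p = poly ?r p"
      by (subst f) (simp only: poly_add poly_mult poly_L_node poly_power zero_power2 mult_zero_left add_0)
    then show "wt p * poly ?r p = wt p * poly f p" by simp
  qed simp
  ultimately show ?thesis by simp
qed

end

section \<open>The bound $\mathcal R \ge 1/\pi$\<close>

text \<open>The binomial series for exponent -1/2, with coefficients in a visibly nonnegative
  form.\<close>

lemma inverse_sqrt_series:
  assumes "\<bar>u\<bar> < (1::real)"
  shows "(\<lambda>k. pochhammer (1/2) k / fact k * u ^ (2 * k)) sums (1 / sqrt (1 - u\<^sup>2))"
proof -
  have u: "u\<^sup>2 < 1" using assms by (simp add: abs_square_less_1)
  then have "(\<lambda>k. ((-1/2) gchoose k) * (-u\<^sup>2) ^ k) sums (1 + - u\<^sup>2) powr (-1/2)"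
    by (intro gen_binomial_real) simp
  moreover have "((-1/2) gchoose k) * (-u\<^sup>2) ^ k = pochhammer (1/2) k / fact k * u ^ (2 * k)" for k
    by (simp add: gbinomial_pochhammer power_mult power_minus[of "u\<^sup>2"])
  moreover have "(1 + - u\<^sup>2) powr (-1/2) = 1 / sqrt (1 - u\<^sup>2)"
    using u powr_minus_divide[of "1 - u\<^sup>2" "1/2"] by (simp add: powr_half_sqrt)
  ultimately show ?thesis by simp
qed

text \<open>Truncated expansion of 1/sqrt(t(1 - t)) about t = 1/2; the leading 2 comes from 1 - (2t
  - 1)^2 = 4t(1 - t).\<close>

definition arcsine_taylor :: "nat \<Rightarrow> real poly" where
  "arcsine_taylor K = (\<Sum>k<K. smult (2 * (pochhammer (1/2) k / fact k)) ([:-1, 2:] ^ (2 * k)))"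

lemma poly_arcsine_taylor:
  "poly (arcsine_taylor K) t = 2 * (\<Sum>k<K. pochhammer (1/2) k / fact k * (2 * t - 1) ^ (2 * k))"
  by (simp add: arcsine_taylor_def poly_sum sum_distrib_left mult.assoc mult.commute)

lemma arcsine_density_eq:
  assumes "0 < t" "t < (1::real)"
  shows "2 * (1 / sqrt (1 - (2 * t - 1)\<^sup>2)) = 1 / sqrt (t * (1 - t))"
proof -
  have "1 - (2 * t - 1)\<^sup>2 = 2\<^sup>2 * (t * (1 - t))"
    by (simp add: power2_eq_square algebra_simps)
  then have "sqrt (1 - (2 * t - 1)\<^sup>2) = 2 * sqrt (t * (1 - t))"
    by (simp only: real_sqrt_mult real_sqrt_abs abs_numeral)
  then show ?thesis using assms by simp
qed

lemma arcsine_taylor_LIMSEQ: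
  assumes "0 < t" "t < 1"
  shows "(\<lambda>K. poly (arcsine_taylor K) t) \<longlonglongrightarrow> 1 / sqrt (t * (1 - t))"
  using tendsto_mult_left[of _ _ sequentially 2, OF inverse_sqrt_series[of "2 * t - 1", unfolded sums_def]] assms
  unfolding poly_arcsine_taylor arcsine_density_eq[OF assms, symmetric] by auto

lemma arcsine_taylor_le:
  assumes "0 < t" "t < 1"
  shows "poly (arcsine_taylor K) t \<le> 1 / sqrt (t * (1 - t))"
proof -
  have s: "(\<lambda>k. pochhammer (1/2) k / fact k * (2 * t - 1) ^ (2 * k)) sums (1 / sqrt (1 - (2 * t - 1)\<^sup>2))"
    using assms by (intro inverse_sqrt_series) auto
  have "(\<Sum>k<K. pochhammer (1/2) k / fact k * (2 * t - 1) ^ (2 * k)) \<le> 1 / sqrt (1 - (2 * t - 1)\<^sup>2)"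
    using s by (subst sums_unique[OF s], intro sum_le_suminf)
      (auto simp: sums_iff intro!: mult_nonneg_nonneg divide_nonneg_nonneg pochhammer_nonneg)
  then show ?thesis
    using arcsine_density_eq[OF assms] by (simp add: poly_arcsine_taylor)
qed

lemma unit_integral_arcsine_taylor_le: "unit_integral (arcsine_taylor K) \<le> pi"
proof -
  \<comment> \<open>At the endpoints the density evaluates to 1/0 = 0, where the comparison could
    fail; changing two values leaves the integral alone.\<close>
  define g where "g t = (if t \<in> {0, 1} then poly (arcsine_taylor K) t else 1 / sqrt (t * (1 - t)))" for t
  have "(g has_integral (arcsin (2 * 1 - 1) - arcsin (2 * 0 - 1))) {0..1}"
  proof (rule fundamental_theorem_of_calculus_interior)
    show "continuous_on {0..1} (\<lambda>t. arcsin (2 * t - 1 :: real))"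
      by (intro continuous_intros) auto
    fix t :: real assume t: "t \<in> {0<..<1}"
    then have "((\<lambda>t. arcsin (2 * t - 1)) has_real_derivative 2 * (1 / sqrt (1 - (2 * t - 1)\<^sup>2))) (at t)"
      by (auto intro!: derivative_eq_intros simp: field_simps)
    then show "((\<lambda>t. arcsin (2 * t - 1)) has_vector_derivative g t) (at t)"
      using t arcsine_density_eq[of t]
      by (simp add: g_def has_real_derivative_iff_has_vector_derivative[symmetric])
  qed simp
  then have "(g has_integral pi) {0..1}" by (simp add: arcsin_minus_1 arcsin_1)
  moreover have "poly (arcsine_taylor K) t \<le> g t" if "t \<in> {0..1}" for t
    using that arcsine_taylor_le[of t K] by (auto simp: g_def)
  ultimately show ?thesis
    unfolding unit_integral_def
    using has_integral_le[OF integrable_integral[OF poly_integrable]] by blast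
qed

lemma higher_pderiv_monom_real:
  assumes "m \<le> j"
  shows "(pderiv ^^ m) (monom (1::real) j) = monom (pochhammer (real (Suc (j - m))) m) (j - m)"
  using assms by (intro poly_eqI) (auto simp: coeff_higher_pderiv)

text \<open>In u = 2t - 1, an even derivative of an even power is a nonnegative multiple of an even
  power. This is the hypothesis of \<open>quadrature_le\<close>.\<close>

lemma higher_pderiv_arcsine_taylor_nonneg: "0 \<le> poly ((pderiv ^^ (2 * n)) (arcsine_taylor K)) x"
proof -
  have "0 \<le> poly ((pderiv ^^ (2 * n)) ([:-1, 2:] ^ (2 * k))) x" for k
  proof -
    have "pcompose (monom 1 (2 * k)) [:-1, 2::real:] = [:-1, 2:] ^ (2 * k)"
      by (simp add: monom_altdef pcompose_power pcompose_pCons)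
    then have "poly ((pderiv ^^ (2 * n)) ([:-1, 2:] ^ (2 * k))) x =
        2 ^ (2 * n) * poly ((pderiv ^^ (2 * n)) (monom 1 (2 * k))) (2 * x - 1)"
      using higher_pderiv_pcompose_linear[of "2 * n" "monom 1 (2 * k)" "-1" "2::real"]
      by (simp add: poly_pcompose mult.commute)
    moreover have "0 \<le> poly ((pderiv ^^ (2 * n)) (monom 1 (2 * k))) (2 * x - 1)"
    proof (cases "n \<le> k")
      case True
      then show ?thesis
        by (subst higher_pderiv_monom_real)
          (simp_all add: poly_monom pochhammer_nonneg flip: diff_mult_distrib2)
    qed (simp add: higher_pderiv_eq_0 degree_monom_eq)
    ultimately show ?thesis by simp
  qed
  then show ?thesis
    by (simp add: arcsine_taylor_def higher_pderiv_sum higher_pderiv_smult poly_sum)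
       (intro sum_nonneg mult_nonneg_nonneg divide_nonneg_nonneg pochhammer_nonneg; simp)
qed

section \<open>Expectations computed by the quadrature\<close>

lemma fTardos_eq_pderiv:
  assumes "0 < p" "p < 1" "x \<le> l"
  shows "fTardos l x p = sqrt (p * (1 - p)) * poly (pderiv ([:0, 1:] ^ x * [:1, -1:] ^ (l - x))) p"
proof -
  \<comment> \<open>Pulling the common root out of both \<open>sigma\<close> values leaves the two
    summands of the product rule.\<close>
  have s: "sigma p = sqrt (p * (1 - p)) / p" "sigma (1 - p) = sqrt (p * (1 - p)) / (1 - p)"
    using assms real_sqrt_mult_self[of p] real_sqrt_mult_self[of "1 - p"]
    by (simp_all add: sigma_def real_sqrt_divide real_sqrt_mult frac_eq_eq del: real_sqrt_mult_self)
  have 1: "real x * p ^ x / p = real x * p ^ (x - 1)"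
    using assms by (cases x) auto
  have 2: "real (l - x) * (1 - p) ^ (l - x) / (1 - p) = real (l - x) * (1 - p) ^ (l - x - 1)"
    using assms by (cases "l - x") auto
  have "fTardos l x p = sqrt (p * (1 - p)) *
     ((1 - p) ^ (l - x) * (real x * p ^ x / p) - p ^ x * (real (l - x) * (1 - p) ^ (l - x) / (1 - p)))"
    unfolding fTardos_def s by (simp add: algebra_simps)
  also have "\<dots> = sqrt (p * (1 - p)) * poly (pderiv ([:0, 1:] ^ x * [:1, -1:] ^ (l - x))) p"
    unfolding 1 2 by (simp add: pderiv_mult pderiv_power pderiv_pCons algebra_simps)
  finally show ?thesis .
qed

context gauss_quadrature
begin

definition arcsine_sum :: real where
  "arcsine_sum = (\<Sum>p\<in>nodes. wt p / sqrt (p * (1 - p)))"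

text \<open>The quadrature underestimates the integral of each Taylor polynomial, which is at most
  \<open>pi\<close>; the limit is taken at finitely many nodes.\<close>

lemma arcsine_sum_le_pi: "arcsine_sum \<le> pi"
proof (rule LIMSEQ_le_const2)
  show "(\<lambda>K. \<Sum>p\<in>nodes. wt p * poly (arcsine_taylor K) p) \<longlonglongrightarrow> arcsine_sum"
    unfolding arcsine_sum_def
    using tendsto_mult_left[OF arcsine_taylor_LIMSEQ] nodes_bounds
    by (intro tendsto_sum) fastforce
  show "\<exists>N. \<forall>K\<ge>N. (\<Sum>p\<in>nodes. wt p * poly (arcsine_taylor K) p) \<le> pi"
    using quadrature_le[OF higher_pderiv_arcsine_taylor_nonneg] unit_integral_arcsine_taylor_le
    by (meson order_trans)
qed

lemma arcsine_sum_pos: "0 < arcsine_sum"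
  unfolding arcsine_sum_def
  using finite_nodes card_nodes n_pos wt_pos nodes_bounds by (intro sum_pos) force+

text \<open>The factor \<open>\<kappa>\<close> cancels by normalisation, and the root in
  \<open>g\<close> cancels the one in the weights.\<close>

lemma fexp_quadrature:
  assumes w: "\<And>p. p \<in> nodes \<Longrightarrow> w p = \<kappa> * (wt p / sqrt (p * (1 - p)))" and "\<kappa> \<noteq> 0"
    and g: "\<And>p. p \<in> nodes \<Longrightarrow> g p = sqrt (p * (1 - p)) * poly h p" and "degree h < 2 * n"
  shows "fexp nodes w g = unit_integral h / arcsine_sum"
proof -
  have "(\<Sum>p\<in>nodes. w p * g p) = (\<Sum>p\<in>nodes. \<kappa> * (wt p * poly h p))"
    using nodes_bounds by (intro sum.cong) (force simp: w g)+
  also have "\<dots> = \<kappa> * unit_integral h"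
    by (simp add: quadrature_exact[OF assms(4)] sum_distrib_left)
  finally have "(\<Sum>p\<in>nodes. w p * g p) = \<kappa> * unit_integral h" .
  moreover have "(\<Sum>p\<in>nodes. w p) = \<kappa> * arcsine_sum"
    by (simp add: arcsine_sum_def sum_distrib_left w)
  ultimately show ?thesis
    using assms(2) by (simp add: fexp_def)
qed

text \<open>Up to the factor $\sqrt{p(1-p)}$, which the weights cancel, $f_{\ell,x}$ is the derivative of
  $p^x(1-p)^{\ell-x}$. Hence its expectation is computed exactly by the quadrature and vanishes
  for $0 < x < \ell$.\<close>

lemma calR_quadrature:
  assumes w: "\<And>p. p \<in> nodes \<Longrightarrow> w p = \<kappa> * (wt p / sqrt (p * (1 - p)))" and "\<kappa> \<noteq> 0"
    and l: "1 \<le> l" "l \<le> 2 * n"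
  shows "calR nodes w l = 1 / arcsine_sum"
proof -
  let ?h = "\<lambda>x. [:0, 1:] ^ x * [:1, -1:] ^ (l - x) :: real poly"
  have deg: "degree (pderiv (?h x)) < 2 * n" if "x \<le> l" for x
    using that l by (simp add: degree_pderiv degree_mult_eq degree_power_eq)
  have "Rlx nodes w l x = 0" if "x \<in> {1..l-1}" for x
  proof -
    have "fexp nodes w (fTardos l x) = unit_integral (pderiv (?h x)) / arcsine_sum"
      using that nodes_bounds by (intro fexp_quadrature[OF w assms(2)] fTardos_eq_pderiv deg) auto
    also have "unit_integral (pderiv (?h x)) = 0"
      using that l by (auto simp: unit_integral_pderiv power_0_left)
    finally show ?thesis by (simp add: Rlx_def)
  qed
  moreover have "fexp nodes w (\<lambda>p. - fTardos l 0 p) = unit_integral (- pderiv (?h 0)) / arcsine_sum"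
  proof (rule fexp_quadrature[OF w assms(2)])
    fix p assume "p \<in> nodes"
    then show "- fTardos l 0 p = sqrt (p * (1 - p)) * poly (- pderiv (?h 0)) p"
      using fTardos_eq_pderiv[of p 0 l] nodes_bounds by simp
  qed (use deg[of 0] in simp_all)
  \<comment> \<open>For \<open>x = 0\<close> the polynomial (1 - p)^l falls from 1 to 0.\<close>
  moreover have "unit_integral (- pderiv (?h 0)) = 1"
    using unit_integral_smult[of "-1" "pderiv (?h 0)"] l by (simp add: unit_integral_pderiv)
  ultimately show ?thesis by (simp add: calR_def)
qed

end

section \<open>The Gauss-Legendre distribution as an instance\<close>

lemma gauss_quadrature_Ltilde:
  assumes "0 < \<nu>"
  shows "gauss_quadrature (Ltilde \<nu>) \<nu>"
proof
  show "(poly (Ltilde \<nu>) 0)\<^sup>2 = (poly (Ltilde \<nu>) 1)\<^sup>2"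
    using poly_Ltilde_reflect[of \<nu> 0] by (simp add: power_mult_distrib flip: power_mult)
qed (use assms card_Ltilde_roots Ltilde_roots_subset Ltilde_orthogonal in auto)

text \<open>With \<open>n = c div 2\<close>, the range of exactness covers every \<open>l\<close> up
  to \<open>c\<close>, so one value \<open>R\<close> serves them all and the minimum over
  \<open>l\<close> is trivial.\<close>

lemma calR_GL:
  assumes "even c" "0 < c"
  obtains R where "1 / pi \<le> R" "\<And>l. l \<in> {1..c} \<Longrightarrow> calR (GL_support c) (GL_weight c) l = R"
proof -
  interpret gauss_quadrature "Ltilde (c div 2)" "c div 2"
    using assms by (intro gauss_quadrature_Ltilde) auto
  have S: "GL_support c = nodes"
    by (simp add: GL_support_def nodes_def)
  \<comment> \<open>By \<open>wt_eq\<close>, this factor turns \<open>wt p\<close> into 1/(p(1 -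
    p)L'(p)^2); the remaining half power in \<open>GL_weight\<close> is the root.\<close>
  let ?\<kappa> = "1 / (poly (Ltilde (c div 2)) 1)\<^sup>2"
  have w: "GL_weight c p = ?\<kappa> * (wt p / sqrt (p * (1 - p)))" if "p \<in> nodes" for p
  proof -
    have p: "0 < p * (1 - p)" using nodes_bounds[OF that] by simp
    have "wt p = (poly (Ltilde (c div 2)) 1)\<^sup>2 / (p * (1 - p)) / (poly (pderiv (Ltilde (c div 2))) p)\<^sup>2"
      using poly_pderiv_L_nonzero[OF that] by (simp flip: wt_eq[OF that])
    moreover have "(p * (1 - p)) powr (3/2) = p * (1 - p) * sqrt (p * (1 - p))"
      using p powr_add[of "p * (1 - p)" 1 "1/2"] by (simp add: powr_half_sqrt)
    ultimately show ?thesis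
      using poly_L_1_nonzero by (simp add: GL_weight_def)
  qed
  have "calR (GL_support c) (GL_weight c) l = 1 / arcsine_sum" if "l \<in> {1..c}" for l
    unfolding S using that assms poly_L_1_nonzero by (intro calR_quadrature[OF w]) auto
  moreover have "1 / pi \<le> 1 / arcsine_sum"
    using arcsine_sum_le_pi arcsine_sum_pos by (intro divide_left_mono) auto
  ultimately show ?thesis by (rule that[rotated])
qed

section \<open>The smallest node\<close>

text \<open>The summand C(\<open>\<nu>\<close>, k) C(\<open>\<nu>\<close> + k, k) t^k; with
  alternating signs these sum to the classical Legendre polynomial at 1 - 2t.\<close>

definition legendre_term :: "nat \<Rightarrow> real \<Rightarrow> nat \<Rightarrow> real" where
  "legendre_term \<nu> t k = real (\<nu> choose k) * pochhammer (real (Suc k)) \<nu> / fact \<nu> * t ^ k"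

lemma coeff_higher_pderiv_kernel_poly:
  "coeff ((pderiv ^^ \<nu>) (kernel_poly ^ \<nu>)) k =
     pochhammer (real (Suc k)) \<nu> * (real (\<nu> choose k) * (-1) ^ (\<nu> - k))"
proof -
  have fac: "kernel_poly = [:0, 1:] * [:-1, 1:]"
    by (simp add: kernel_poly_def)
  have "kernel_poly ^ \<nu> = monom 1 \<nu> * [:-1, 1:] ^ \<nu>"
    unfolding fac power_mult_distrib monom_altdef smult_1_left ..
  moreover have "coeff ([:-1, 1::real:] ^ \<nu>) k = real (\<nu> choose k) * (-1) ^ (\<nu> - k)"
    by (cases "k \<le> \<nu>")
      (simp_all add: coeff_linear_poly_power coeff_eq_0 degree_power_eq binomial_eq_0)
  ultimately show ?thesis
    by (simp add: coeff_higher_pderiv coeff_monom_mult)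
qed

text \<open>Terms beyond \<open>\<nu>\<close> vanish, so the upper limit is free and can later be
  taken even.\<close>

lemma poly_Ltilde:
  assumes "\<nu> < K"
  shows "poly (Ltilde \<nu>) t = 2 ^ \<nu> * (-1) ^ \<nu> * fact \<nu> * (\<Sum>k<K. (-1) ^ k * legendre_term \<nu> t k)"
proof -
  have "poly (Ltilde \<nu>) t = 2 ^ \<nu> * (\<Sum>k\<le>\<nu>. coeff ((pderiv ^^ \<nu>) (kernel_poly ^ \<nu>)) k * t ^ k)"
    using degree_Ltilde[of \<nu>] by (simp add: Ltilde_Rodrigues poly_altdef sum_distrib_left mult.assoc)
  also have "(\<Sum>k\<le>\<nu>. coeff ((pderiv ^^ \<nu>) (kernel_poly ^ \<nu>)) k * t ^ k) =
      (\<Sum>k\<le>\<nu>. (-1) ^ \<nu> * fact \<nu> * ((-1) ^ k * legendre_term \<nu> t k))"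
    by (intro sum.cong)
       (simp_all add: coeff_higher_pderiv_kernel_poly legendre_term_def uminus_power_if)
  also have "\<dots> = (\<Sum>k<K. (-1) ^ \<nu> * fact \<nu> * ((-1) ^ k * legendre_term \<nu> t k))"
    using assms by (intro sum.mono_neutral_left) (auto simp: legendre_term_def)
  finally show ?thesis
    by (simp add: sum_distrib_left mult.assoc)
qed

lemma legendre_term_0: "legendre_term \<nu> t 0 = 1"
  by (simp add: legendre_term_def pochhammer_fact[symmetric])

text \<open>The ratio is t(\<open>\<nu>\<close> - k)(\<open>\<nu>\<close> + k + 1)/(k + 1)^2,
  rewritten so that it depends on \<open>\<nu>\<close> only through
  \<open>\<nu>\<close>(\<open>\<nu>\<close> + 1), as the comparison with the Bessel series
  needs.\<close>

lemma legendre_term_Suc: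
  "legendre_term \<nu> t (Suc k) =
     legendre_term \<nu> t k * (t * (real \<nu> * (real \<nu> + 1) - real k * (real k + 1)) / (real (Suc k))\<^sup>2)"
proof -
  have "Suc k * (\<nu> choose Suc k) = (\<nu> choose k) * (\<nu> - k)"
    using binomial_absorb_comp[of \<nu> k] binomial_absorption[of k "\<nu>"]
    by (metis Suc_times_binomial_eq binomial_absorption mult.commute times_binomial_minus1_eq)
  then have 1: "real (Suc k) * real (\<nu> choose Suc k) = real (\<nu> choose k) * (real \<nu> - real k)"
  proof (cases "k \<le> \<nu>")
    case True
    then show ?thesis
      using arg_cong[OF \<open>Suc k * (\<nu> choose Suc k) = (\<nu> choose k) * (\<nu> - k)\<close>, of real]
      by (simp only: of_nat_mult of_nat_diff)
  qed (simp add: binomial_eq_0)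
  have 2: "real (Suc k) * pochhammer (real (Suc (Suc k))) \<nu> = pochhammer (real (Suc k)) \<nu> * (real k + 1 + real \<nu>)"
    using pochhammer_rec[of "real (Suc k)" \<nu>] pochhammer_rec'[of "real (Suc k)" \<nu>]
    by (simp add: algebra_simps)
  have "legendre_term \<nu> t (Suc k) * (real (Suc k))\<^sup>2 =
      (real (Suc k) * real (\<nu> choose Suc k)) * (real (Suc k) * pochhammer (real (Suc (Suc k))) \<nu>) / fact \<nu> * t ^ Suc k"
    by (simp add: legendre_term_def power2_eq_square)
  also have "\<dots> = legendre_term \<nu> t k * (t * (real \<nu> * (real \<nu> + 1) - real k * (real k + 1)))"
    unfolding 1 2 by (simp add: legendre_term_def field_simps)
  finally show ?thesis
    by (simp add: eq_divide_eq)
qed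

lemma legendre_term_nonneg: "0 \<le> t \<Longrightarrow> 0 \<le> legendre_term \<nu> t k"
  by (simp add: legendre_term_def pochhammer_nonneg)

lemma alternating_sum_ge:
  fixes T :: "nat \<Rightarrow> real"
  assumes "\<And>m. M \<le> m \<Longrightarrow> T (2 * m + 1) \<le> T (2 * m)"
  shows "(\<Sum>k<2 * M. (-1) ^ k * T k) \<le> (\<Sum>k<2 * (M + d). (-1) ^ k * T k)"
proof (induction d)
  case (Suc d)
  then show ?case using assms[of "M + d"] by simp
qed simp

text \<open>The sum of the first six terms tends to the corresponding Taylor polynomial of $J_0(2\sqrt s)$
  with $s = \nu(\nu+1)t$, whose smallest zero is about $1.44576$.\<close>

lemma six_terms_pos:
  fixes s N :: real
  assumes s: "0 \<le> s" "s \<le> 1.445" and N: "10 ^ 6 \<le> N"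
  defines "T2 \<equiv> s\<^sup>2 / 4 * (1 - 2 / N)"
  defines "T3 \<equiv> T2 * (s * (1 - 6 / N) / 9)"
  defines "T4 \<equiv> T3 * (s * (1 - 12 / N) / 16)"
  defines "T5 \<equiv> T4 * (s * (1 - 20 / N) / 25)"
  shows "0 < 1 - s + T2 - T3 + T4 - T5"
proof -
  define e where "e = 1 / N"
  have e: "0 \<le> e" "e \<le> 1 / 10 ^ 6"
    using N by (simp_all add: e_def field_simps)
  have E: "2 / N = 2 * e" "6 / N = 6 * e" "12 / N = 12 * e" "20 / N = 20 * e"
    by (simp_all add: e_def)
  have T3: "T3 = s ^ 3 / 36 * ((1 - 2 * e) * (1 - 6 * e))"
    by (simp add: T3_def T2_def E power2_eq_square power3_eq_cube)
  have T4: "T4 = s ^ 4 / 576 * ((1 - 2 * e) * (1 - 6 * e) * (1 - 12 * e))"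
    unfolding T4_def T3 by (simp add: E power2_eq_square power3_eq_cube power4_eq_xxxx)
  have T5: "T5 = s ^ 5 / 14400 * ((1 - 2 * e) * (1 - 6 * e) * (1 - 12 * e) * (1 - 20 * e))"
    unfolding T5_def T4 by (simp add: E power4_eq_xxxx eval_nat_numeral)
  have prod2: "(1 - 2 * e) * (1 - 6 * e) \<le> 1"
    using e by (intro mult_le_one) auto
  have prod4: "(1 - 2 * e) * (1 - 6 * e) * (1 - 12 * e) * (1 - 20 * e) \<le> 1"
    using e by (intro mult_le_one mult_nonneg_nonneg) auto
  have "1 - 8 * e \<le> (1 - 2 * e) * (1 - 6 * e)"
    by (simp add: algebra_simps)
  then have "(1 - 8 * e) * (1 - 12 * e) \<le> (1 - 2 * e) * (1 - 6 * e) * (1 - 12 * e)"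
    using e by (intro mult_right_mono) auto
  moreover have "1 - 20 * e \<le> (1 - 8 * e) * (1 - 12 * e)"
    by (simp add: algebra_simps)
  ultimately have prod3: "1 - 20 * e \<le> (1 - 2 * e) * (1 - 6 * e) * (1 - 12 * e)"
    by linarith
  have s2: "s\<^sup>2 \<le> 1.445\<^sup>2" "s ^ 4 \<le> 1.445 ^ 4"
    using s by (intro power_mono; simp)+
  have "s\<^sup>2 * e \<le> 1.445\<^sup>2 * (1 / 10 ^ 6)" "s ^ 4 * e \<le> 1.445 ^ 4 * (1 / 10 ^ 6)"
    using s2 e by (intro mult_mono; simp)+
  then have small: "s\<^sup>2 * e \<le> 3 / 10 ^ 6" "s ^ 4 * e \<le> 5 / 10 ^ 6"
    by (simp_all add: power2_eq_square power4_eq_xxxx)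
  have b2: "s\<^sup>2 / 4 - 2 / 10 ^ 6 \<le> T2"
    using small by (simp add: T2_def E algebra_simps)
  have b3: "T3 \<le> s ^ 3 / 36"
    unfolding T3 using prod2 s by (intro mult_left_le) auto
  have "s ^ 4 / 576 * (1 - 20 * e) \<le> T4"
    unfolding T4 using prod3 s by (intro mult_left_mono) auto
  then have b4: "s ^ 4 / 576 - 1 / 10 ^ 6 \<le> T4"
    using small by (simp add: algebra_simps)
  have b5: "T5 \<le> s ^ 5 / 14400"
    unfolding T5 using prod4 s by (intro mult_left_le) auto
  \<comment> \<open>Expanded about the right endpoint, the quintic below has only positive coefficients.\<close>
  define y where "y = 1.445 - s"
  have y: "0 \<le> y" "s = 1.445 - y" using s by (simp_all add: y_def)
  \<comment> \<open>The margin \<open>7 / 10 ^ 5\<close> exceeds the total loss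
    \<open>3 / 10 ^ 6\<close> incurred in \<open>b2\<close> and \<open>b4\<close>.\<close>
  have "0 < 1 - 7 / 10 ^ 5 - s + s\<^sup>2 / 4 - s ^ 3 / 36 + s ^ 4 / 576 - s ^ 5 / 14400"
  proof -
    have "1 - 7 / 10 ^ 5 - s + s\<^sup>2 / 4 - s ^ 3 / 36 + s ^ 4 / 576 - s ^ 5 / 14400 =
      394643101517 / 1536000000000000 + 663649027147 / 1536000000000 * y +
      1719225431 / 11520000000 * y ^ 2 + 368507 / 19200000 * y ^ 3 + 79 / 64000 * y ^ 4 + y ^ 5 / 14400"
      unfolding y(2) by (simp add: eval_nat_numeral field_simps)
    also have "\<dots> > 0"
      using y(1) by (intro add_pos_nonneg) auto
    finally show ?thesis .
  qed
  then show ?thesis using b2 b3 b4 b5 by simp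
qed

text \<open>The first six terms have a positive sum and all later terms pair off nonnegatively,
  their ratios being at most 1.445/(2m + 1)^2.\<close>

lemma poly_Ltilde_nonzero_near_0:
  assumes "1000 \<le> \<nu>" "0 \<le> t" "t * (real \<nu> * (real \<nu> + 1)) \<le> 1.445"
  shows "poly (Ltilde \<nu>) t \<noteq> 0"
proof -
  define N where "N = real \<nu> * (real \<nu> + 1)"
  define s where "s = t * N"
  let ?T = "legendre_term \<nu> t"
  have "1000 * 1000 \<le> N"
    unfolding N_def using assms(1) by (intro mult_mono) auto
  then have N: "10 ^ 6 \<le> N" by simp
  have s: "0 \<le> s" "s \<le> 1.445"
    using assms N by (simp_all add: s_def N_def)
  have Suc: "?T (Suc k) = ?T k * (s * (1 - real k * (real k + 1) / N) / (real (Suc k))\<^sup>2)" for k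
    unfolding legendre_term_Suc N_def[symmetric] s_def using N by (simp add: field_simps)
  have T0: "?T 0 = 1" "?T 1 = s"
    using Suc[of 0] by (simp_all add: legendre_term_0)
  have T2: "?T 2 = s\<^sup>2 / 4 * (1 - 2 / N)"
    using Suc[of 1, unfolded Suc_1 T0(2)] by (simp add: power2_eq_square)
  have T3: "?T 3 = ?T 2 * (s * (1 - 6 / N) / 9)"
    using Suc[of 2] by simp
  have T4: "?T 4 = ?T 3 * (s * (1 - 12 / N) / 16)"
    using Suc[of 3] by simp
  have T5: "?T 5 = ?T 4 * (s * (1 - 20 / N) / 25)"
    using Suc[of 4] by simp
  have dec: "?T (2 * m + 1) \<le> ?T (2 * m)" if "3 \<le> m" for m
  proof -
    have "s * (1 - real (2 * m) * (real (2 * m) + 1) / N) \<le> s * 1"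
      using s N by (intro mult_left_mono) auto
    also have "\<dots> \<le> 1.445" using s by simp
    also have "\<dots> \<le> (real (Suc (2 * m)))\<^sup>2"
      using that power_mono[of 2 "real (Suc (2 * m))" 2] by simp
    finally have "s * (1 - real (2 * m) * (real (2 * m) + 1) / N) / (real (Suc (2 * m)))\<^sup>2 \<le> 1"
      by (simp add: divide_le_eq_1)
    then show ?thesis
      unfolding Suc_eq_plus1[symmetric] Suc by (rule mult_left_le[OF _ legendre_term_nonneg[OF assms(2)]])
  qed
  have "(\<Sum>k<2 * 3. (-1) ^ k * ?T k) = ?T 0 - ?T 1 + ?T 2 - ?T 3 + ?T 4 - ?T 5"
    by (simp add: eval_nat_numeral)
  also have "0 < \<dots>"
    using six_terms_pos[OF s N] unfolding T5 T4 T3 T2 T0 .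
  finally have "0 < (\<Sum>k<2 * 3. (-1) ^ k * ?T k)" .
  also have "\<dots> \<le> (\<Sum>k<2 * (3 + \<nu>). (-1) ^ k * ?T k)"
    by (rule alternating_sum_ge) (use dec in auto)
  finally show ?thesis
    by (subst poly_Ltilde[of \<nu> "2 * (3 + \<nu>)"]) auto
qed

lemma sigma_Min_GL_support_le:
  assumes "even c" "2000 \<le> c"
  shows "0 \<le> sigma (Min (GL_support c))" "sigma (Min (GL_support c)) \<le> 0.4162 * real c"
proof -
  define \<nu> where "\<nu> = c div 2"
  have \<nu>: "1000 \<le> \<nu>" "real c = 2 * real \<nu>"
    using assms by (auto simp: \<nu>_def)
  have "GL_support c \<noteq> {}"
    using card_Ltilde_roots[of \<nu>] \<nu> unfolding GL_support_def \<nu>_def[symmetric] by force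
  then have "Min (GL_support c) \<in> GL_support c"
    using finite_Ltilde_roots by (intro Min_in) (simp_all add: GL_support_def)
  then obtain p where p: "p = Min (GL_support c)" "poly (Ltilde \<nu>) p = 0" "0 < p" "p < 1"
    using Ltilde_roots_subset[of \<nu>] by (auto simp: GL_support_def \<nu>_def)
  have "1.445 < p * (real \<nu> * (real \<nu> + 1))"
    using poly_Ltilde_nonzero_near_0[OF \<nu>(1), of p] p by fastforce
  then have "1 / p \<le> real \<nu> * (real \<nu> + 1) / 1.445"
    using p by (simp add: field_simps)
  \<comment> \<open>0.4162 slightly exceeds 1/(2 sqrt 1.445) = 0.41594...; the slack absorbs the
    factor 1 + 1/\<open>\<nu>\<close> for \<open>\<nu>\<close> at least 1000.\<close>
  also have "\<dots> \<le> (0.4162 * real c)\<^sup>2"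
    using \<nu> by (simp add: power2_eq_square field_simps)
  finally have "(1 - p) / p \<le> (0.4162 * real c)\<^sup>2"
    using p by (simp add: diff_divide_distrib)
  then show "sigma (Min (GL_support c)) \<le> 0.4162 * real c"
    unfolding sigma_def p(1)[symmetric] by (intro real_le_lsqrt) simp_all
  show "0 \<le> sigma (Min (GL_support c))"
    unfolding sigma_def p(1)[symmetric] using p by simp
qed

section \<open>The function r and the code length\<close>

text \<open>The positive coefficients give monotonicity termwise.\<close>

lemma r_fun_sums:
  assumes "x \<noteq> 0"
  shows "(\<lambda>n. x ^ n / fact (n + 2)) sums r_fun x"
proof -
  have "(\<lambda>n. x ^ n / fact n) sums exp x"
    using exp_converges[of x] by (simp add: field_simps)
  then have "(\<lambda>n. x ^ (n + 2) / fact (n + 2)) sums (exp x - (\<Sum>n<2. x ^ n / fact n))"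
    by (subst sums_iff_shift) simp
  then have "(\<lambda>n. x ^ (n + 2) / fact (n + 2) / x\<^sup>2) sums ((exp x - (\<Sum>n<2. x ^ n / fact n)) / x\<^sup>2)"
    by (rule sums_divide)
  moreover have "x ^ (n + 2) / fact (n + 2) / x\<^sup>2 = x ^ n / fact (n + 2)" for n
    unfolding power_add using assms by (simp del: fact_Suc of_nat_Suc add_2_eq_Suc')
  ultimately show ?thesis
    by (simp add: r_fun_def eval_nat_numeral diff_diff_eq)
qed

lemma r_fun_mono:
  assumes "0 < x" "x \<le> y"
  shows "r_fun x \<le> r_fun y"
  using assms by (intro sums_le[OF _ r_fun_sums r_fun_sums] divide_right_mono power_mono) auto

lemma r_fun_bounds:
  assumes "0 < x" "x \<le> 1"
  shows "1/2 + x/6 + x\<^sup>2/24 + x^3/120 \<le> r_fun x" "r_fun x \<le> 1/2 + x/6 + x\<^sup>2/24 + x^3/120 + x^4/240"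
proof -
  obtain t where t: "\<bar>t\<bar> \<le> \<bar>x\<bar>" "exp x = (\<Sum>m<6. x ^ m / fact m) + exp t / fact 6 * x ^ 6"
    using Maclaurin_exp_le[of x 6] by auto
  have "(\<Sum>m<6. x ^ m / fact m) = 1 + x + x\<^sup>2 * (1/2 + x/6 + x\<^sup>2/24 + x^3/120)"
    by (simp add: eval_nat_numeral algebra_simps)
  then have r: "r_fun x = 1/2 + x/6 + x\<^sup>2/24 + x^3/120 + exp t / 720 * x ^ 4"
    using assms unfolding r_fun_def t(2) by (simp add: eval_nat_numeral field_simps)
  have "exp t \<le> exp 1" using t(1) assms by simp
  then have "exp t \<le> 3" using exp_le by linarith
  then have "exp t / 720 * x ^ 4 \<le> 3 / 720 * x ^ 4"
    using assms by (intro mult_right_mono divide_right_mono) auto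
  then show "r_fun x \<le> 1/2 + x/6 + x\<^sup>2/24 + x^3/120 + x^4/240" using r by simp
  show "1/2 + x/6 + x\<^sup>2/24 + x^3/120 \<le> r_fun x"
    using r assms by simp
qed

text \<open>The threshold 0.12695 satisfies both requirements: large enough for the
  \<open>sigma\<close> bound 0.4162 and small enough for the target 10.301, half of the final
  constant up to slack.\<close>

lemma r_fun_numeric:
  "2 * pi\<^sup>2 * r_fun 0.12695 \<le> 10.301" "0.4162 \<le> 2 * pi * 0.12695 * r_fun 0.12695"
proof -
  have pos: "0 \<le> r_fun 0.12695"
    using r_fun_bounds(1)[of "0.12695"] by (rule order_trans[rotated]) simp_all
  have "pi\<^sup>2 \<le> 3.1415926535899\<^sup>2"
    using pi_approx by (intro power_mono) auto
  then have "pi\<^sup>2 * r_fun 0.12695 \<le> 3.1415926535899\<^sup>2 * (1/2 + 0.12695/6 + 0.12695\<^sup>2/24 + 0.12695^3/120 + 0.12695^4/240)"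
    using r_fun_bounds(2)[of "0.12695"] pos by (intro mult_mono) simp_all
  also have "\<dots> \<le> 5.1505" by (simp add: eval_nat_numeral)
  finally show "2 * pi\<^sup>2 * r_fun 0.12695 \<le> 10.301" by simp
  have "3.141592653588 * (1/2 + 0.12695/6 + 0.12695\<^sup>2/24 + 0.12695^3/120) \<le> pi * r_fun 0.12695"
    using r_fun_bounds[of "0.12695"] pi_approx by (intro mult_mono) auto
  moreover have "0.4162 \<le> 2 * 0.12695 * (3.141592653588 * (1/2 + 0.12695/6 + 0.12695\<^sup>2/24 + 0.12695^3/120 :: real))"
    by (simp add: eval_nat_numeral)
  ultimately show "0.4162 \<le> 2 * pi * 0.12695 * r_fun 0.12695" by simp
qed

text \<open>\<open>X\<close> is a free threshold, so \<open>x\<close> need not be solved for. If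
  \<open>x\<close> is at most \<open>X\<close>, eliminating \<open>\<psi>\<close> leaves r(x)/(k
  R^2), bounded by monotonicity; otherwise \<open>\<psi>\<close> and 1/\<open>x\<close> are bounded
  directly.\<close>

lemma sigma_ratio_le:
  assumes "0 < x" "0 < X" "1 / pi \<le> R" "0 \<le> \<psi>" "\<psi> \<le> a" "x * r_fun x = k * R * \<psi>" "0 < k"
  shows "\<psi> / (x * R) \<le> max (pi\<^sup>2 * r_fun X / k) (a * pi / X)"
proof -
  have R: "0 < R" "1 / R \<le> pi"
  proof -
    show "0 < R" using assms(3) pi_gt_zero by (meson divide_pos_pos less_le_trans zero_less_one)
    then show "1 / R \<le> pi" using assms(3) by (simp add: field_simps)
  qed
  show ?thesis
  proof (cases "x \<le> X")
    case True
    have "\<psi> = x * r_fun x / (k * R)" using assms R by (simp add: field_simps)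
    then have "\<psi> / (x * R) = (1 / R)\<^sup>2 * r_fun x / k"
      using assms(1) R by (simp add: power2_eq_square mult.commute)
    also have "\<dots> \<le> pi\<^sup>2 * r_fun X / k"
    proof (intro divide_right_mono mult_mono)
      have "0 \<le> x * r_fun x" using assms R by simp
      then show "0 \<le> r_fun x" using assms(1) by (simp add: zero_le_mult_iff)
    qed (use assms R True r_fun_mono in \<open>auto intro!: power_mono\<close>)
    finally show ?thesis by simp
  next
    case False
    have "\<psi> / (x * R) = \<psi> * (1 / R) / x" by simp
    also have "\<dots> \<le> a * pi / X"
      using assms R False by (intro frac_le mult_mono) auto
    finally show ?thesis by simp
  qed
qed

section \<open>Asymptotic assembly of the code length bound\<close>

theorem theorem6:
  fixes eps1 eps2 :: "nat \<Rightarrow> real"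
  assumes eps1_range: "\<And>c. 0 < eps1 c \<and> eps1 c < 1"
      and eps2_range: "\<And>c. 0 < eps2 c \<and> eps2 c < 1"
      and ratio_bounded: "\<exists>B. \<forall>\<^sub>F c in sequentially. ln (1 / eps2 c) / ln (1 / eps1 c) \<le> B"
  shows "\<forall>\<^sub>F c in sequentially. even c \<longrightarrow>
    (let S = GL_support c; w = GL_weight c;
         p0 = Min S;
         \<eta>1 = (1/2 :: real); \<eta>2 = sqrt (real c) / 2;
         R = Min ((\<lambda>l. calR S w l) ` {1..c});
         \<psi>1 = sigma p0; \<psi>2 = sigma p0
     in \<forall>x1 x2. x1 > 0 \<longrightarrow> x2 > 0 \<longrightarrow>
          x1 * r_fun x1 = \<eta>1 * R * \<psi>1 / real c \<longrightarrow>
          x2 * r_fun x2 = \<eta>2 * R * \<psi>1 / real c \<longrightarrow>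
          (let A1 = real c / ((1 - \<eta>1 - \<eta>2 / real c) * R) * (\<psi>2 / x1) * ln (1 / eps1 c);
               A2 = real c / ((1 - \<eta>1 - \<eta>2 / real c) * R) * (\<psi>2 / x2) * ln (1 / eps2 c)
           in A1 + A2 < 0.206021 * 100 * (real c)\<^sup>2 * ln (1 / eps1 c)))"
proof -
  obtain B0 where B0: "\<forall>\<^sub>F c in sequentially. ln (1 / eps2 c) / ln (1 / eps1 c) \<le> B0"
    using ratio_bounded by blast
  define B where "B = max B0 1"
  \<comment> \<open>The budget for the second summand: even after multiplication by the ratio bound
    \<open>B\<close> it contributes only \<open>1 / 10 ^ 5\<close>.\<close>
  define \<delta> where "\<delta> = 1 / (10 ^ 5 * B)"
  \<comment> \<open>The threshold for \<open>x2\<close>, chosen so that the second alternative in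
    \<open>sigma_ratio_le\<close> equals \<open>real c * \<delta>\<close>.\<close>
  define M where "M = 0.4162 * pi / \<delta>"
  have B: "1 \<le> B" by (simp add: B_def)
  then have \<delta>: "0 < \<delta>" "\<delta> * B = 1 / 10 ^ 5" by (simp_all add: \<delta>_def)
  then have M: "0 < M" "0.4162 * pi / M = \<delta>" by (simp_all add: M_def)
  have sqrt_top: "filterlim (\<lambda>c. sqrt (real c)) at_top sequentially"
    using filterlim_compose[OF sqrt_at_top filterlim_real_sequentially] .
  \<comment> \<open>The first entry brings \<open>q\<close> close to 1/2; the second handles the
    case \<open>x2 \<le> M\<close>.\<close>
  have ev1: "\<forall>\<^sub>F c in sequentially. max (10 ^ 6) (2 * pi\<^sup>2 * r_fun M / \<delta>) \<le> sqrt (real c)"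
    using sqrt_top unfolding filterlim_at_top by blast
  show ?thesis
    using B0 ev1 eventually_ge_at_top[of "2000::nat"]
  proof eventually_elim
    case (elim c)
    show ?case
    proof (intro impI)
      assume "even c"
      define R where "R = Min ((\<lambda>l. calR (GL_support c) (GL_weight c) l) ` {1..c})"
      define \<psi> where "\<psi> = sigma (Min (GL_support c))"
      define q where "q = 1 - 1 / 2 - sqrt (real c) / 2 / real c"
      define l1 where "l1 = ln (1 / eps1 c)"
      define l2 where "l2 = ln (1 / eps2 c)"
      have c: "0 < real c" using elim by simp
      obtain R' where R': "1 / pi \<le> R'" "\<And>l. l \<in> {1..c} \<Longrightarrow> calR (GL_support c) (GL_weight c) l = R'"
        using calR_GL[OF \<open>even c\<close>] elim by auto
      have "(\<lambda>l. calR (GL_support c) (GL_weight c) l) ` {1..c} = {R'}"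
        using R'(2) elim by (force simp: image_iff)
      then have R: "1 / pi \<le> R" using R'(1) by (simp add: R_def)
      have \<psi>: "0 \<le> \<psi>" "\<psi> \<le> 0.4162 * real c"
        using sigma_Min_GL_support_le[OF \<open>even c\<close>] elim by (simp_all add: \<psi>_def)
      have l1: "0 < l1" and l2: "l2 \<le> B * l1" "0 < l2"
        using eps1_range[of c] eps2_range[of c] elim(1)
        by (auto simp: l1_def l2_def B_def pos_divide_le_eq intro: order_trans mult_right_mono)
      have sq: "10 ^ 6 \<le> sqrt (real c)" "2 * pi\<^sup>2 * r_fun M / \<delta> \<le> sqrt (real c)"
        using elim(2) by auto
      have cc: "sqrt (real c) / real c = 1 / sqrt (real c)"
        using c by (simp add: field_simps)
      have q: "0.499999 \<le> q"
      proof -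
        have "1 / sqrt (real c) \<le> 1 / 10 ^ 6" using sq(1) c by (intro divide_left_mono) auto
        then show ?thesis using cc by (simp add: q_def)
      qed
      have main: "real c / (q * R) * (\<psi> / x1) * l1 + real c / (q * R) * (\<psi> / x2) * l2
          < 0.206021 * 100 * (real c)\<^sup>2 * l1"
        if x: "0 < x1" "0 < x2" "x1 * r_fun x1 = 1 / 2 * R * \<psi> / real c"
          "x2 * r_fun x2 = sqrt (real c) / 2 * R * \<psi> / real c" for x1 x2
      proof -
        have "\<psi> / (x1 * R) \<le> max (pi\<^sup>2 * r_fun 0.12695 / (1 / (2 * real c))) (0.4162 * real c * pi / 0.12695)"
          using x c by (intro sigma_ratio_le R \<psi>) simp_all
        also have "\<dots> \<le> real c * 10.301"
        proof (rule max.boundedI)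
          show "pi\<^sup>2 * r_fun 0.12695 / (1 / (2 * real c)) \<le> real c * 10.301"
            using mult_left_mono[OF r_fun_numeric(1), of "real c"] by (simp add: algebra_simps)
          \<comment> \<open>The choice of 0.12695 makes the second alternative no larger than the
            bound on the first.\<close>
          have "0.4162 * pi \<le> 2 * pi * 0.12695 * r_fun 0.12695 * pi"
            using r_fun_numeric(2) by (intro mult_right_mono) auto
          also have "\<dots> \<le> 10.301 * 0.12695"
            using r_fun_numeric(1) by (simp add: power2_eq_square)
          finally have "0.4162 * pi / 0.12695 \<le> 10.301" by simp
          then show "0.4162 * real c * pi / 0.12695 \<le> real c * 10.301"
            using mult_left_mono[of "0.4162 * pi / 0.12695" "10.301" "real c"] by (simp add: algebra_simps)
        qed
        finally have 1: "\<psi> / (x1 * R) \<le> real c * 10.301" .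
        have "\<psi> / (x2 * R) \<le> max (pi\<^sup>2 * r_fun M / (sqrt (real c) / 2 / real c)) (0.4162 * real c * pi / M)"
          using x c M by (intro sigma_ratio_le R \<psi>) simp_all
        also have "\<dots> \<le> real c * \<delta>"
        proof (rule max.boundedI)
          have "2 * pi\<^sup>2 * r_fun M \<le> sqrt (real c) * \<delta>"
            using sq(2) \<delta>(1) by (simp add: pos_divide_le_eq)
          then show "pi\<^sup>2 * r_fun M / (sqrt (real c) / 2 / real c) \<le> real c * \<delta>"
            using c by (simp add: field_simps)
          show "0.4162 * real c * pi / M \<le> real c * \<delta>"
            using M(2) by (simp flip: M(2))
        qed
        finally have 2: "\<psi> / (x2 * R) \<le> real c * \<delta>" .
        have "real c / (q * R) * (\<psi> / x1) * l1 + real c / (q * R) * (\<psi> / x2) * l2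
            = real c / q * (\<psi> / (x1 * R) * l1 + \<psi> / (x2 * R) * l2)"
          by (simp add: distrib_left mult_ac)
        also have "\<dots> \<le> real c / q * (real c * 10.301 * l1 + real c * \<delta> * (B * l1))"
          using 1 2 l1 l2 q c \<delta>(1) by (intro mult_left_mono add_mono mult_mono) auto
        also have "\<dots> = (real c)\<^sup>2 * l1 * ((10.301 + \<delta> * B) / q)"
          by (simp add: power2_eq_square algebra_simps add_divide_distrib)
        also have "\<dots> < (real c)\<^sup>2 * l1 * 20.6021"
        proof (rule mult_strict_left_mono)
          \<comment> \<open>10.30101 lies below 20.6021 times 0.499999, which is about
            10.30103.\<close>
          show "(10.301 + \<delta> * B) / q < 20.6021"
            unfolding \<delta>(2) using q by (simp add: pos_divide_less_eq)
        qed (use c l1 in simp)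
        finally show ?thesis by (simp add: mult_ac)
      qed
      show "let S = GL_support c; w = GL_weight c;
         p0 = Min S;
         \<eta>1 = (1/2 :: real); \<eta>2 = sqrt (real c) / 2;
         R = Min ((\<lambda>l. calR S w l) ` {1..c});
         \<psi>1 = sigma p0; \<psi>2 = sigma p0
     in \<forall>x1 x2. x1 > 0 \<longrightarrow> x2 > 0 \<longrightarrow>
          x1 * r_fun x1 = \<eta>1 * R * \<psi>1 / real c \<longrightarrow>
          x2 * r_fun x2 = \<eta>2 * R * \<psi>1 / real c \<longrightarrow>
          (let A1 = real c / ((1 - \<eta>1 - \<eta>2 / real c) * R) * (\<psi>2 / x1) * ln (1 / eps1 c);
               A2 = real c / ((1 - \<eta>1 - \<eta>2 / real c) * R) * (\<psi>2 / x2) * ln (1 / eps2 c)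
           in A1 + A2 < 0.206021 * 100 * (real c)\<^sup>2 * ln (1 / eps1 c))"
        unfolding Let_def R_def[symmetric] \<psi>_def[symmetric] q_def[symmetric]
          l1_def[symmetric] l2_def[symmetric]
        using main by blast
    qed
  qed
qed

end
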